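(* Let $\mathcal{A}\in\mathbb{C}^{m\times\ell\times n}$ be such that $\mathcal{A}_{i::}\mathcal{A}_{i::}^*\in\mathbb{C}^{1\times1\times n}$ is invertible (under the t-product) for every $i\in\{0,\dots,m-1\}$, and let $\mathcal{B}\in\mathbb{C}^{m\times p\times n}$, $\mathcal{X}^0\in\mathbb{C}^{\ell\times p\times n}$. Let $i_0,i_1,\dots\in\{0,\dots,m-1\}$ be any sequence of row indices and let the tensor randomized Kaczmarz iterates be $$\mathcal{X}^{t+1}=\mathcal{X}^t-\mathcal{A}_{i_t::}^*\left(\mathcal{A}_{i_t::}\mathcal{A}_{i_t::}^*\right)^{-1}\left(\mathcal{A}_{i_t::}\mathcal{X}^t-\mathcal{B}_{i_t::}\right),\qquad t\ge0.$$ For $i\in\{0,\dots,m-1\}$ let $\tau_i=\{km+i: 0\le k\le n-1\}$, and let the block Kaczmarz iterates with blocks $\tau_i$ for the Fourier-domain linear system $\mathrm{bdiag}(\widehat{\mathcal{A}})\,\mathbf{Y}=\mathrm{unfold}(\widehat{\mathcal{B}})$ be defined by $\mathbf{Y}^0=\mathrm{unfold}(\widehat{\mathcal{X}^0})$ and $$\mathbf{Y}^{t+1}=\mathbf{Y}^t-\left(\mathrm{bdiag}(\widehat{\mathcal{A}})_{\tau_{i_t}}\right)^{\dagger}\left(\mathrm{bdiag}(\widehat{\mathcal{A}})_{\tau_{i_t}}\mathbf{Y}^t-\mathrm{unfold}(\widehat{\mathcal{B}})_{\tau_{i_t}}\right),\qquad t\ge0.$$ Then the two methods are equivalent: $\mathbf{Y}^t=\mathrm{unfold}(\widehat{\mathcal{X}^t})$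 for all $t\ge0$.
   Context: Indices start at 0. For a third-order tensor $\mathcal{M}\in\mathbb{C}^{m\times\ell\times n}$: $\mathbf{M}_k=\mathcal{M}_{::k}\in\mathbb{C}^{m\times\ell}$ ($0\le k\le n-1$) is its $k$-th frontal slice; $\mathcal{M}_{i::}\in\mathbb{C}^{1\times\ell\times n}$ is its $i$-th row slice. $\mathrm{unfold}(\mathcal{M})\in\mathbb{C}^{mn\times\ell}$ is the matrix obtained by stacking $\mathbf{M}_0,\dots,\mathbf{M}_{n-1}$ vertically, and $\mathrm{fold}$ is its inverse. $\mathrm{bcirc}(\mathcal{M})\in\mathbb{C}^{mn\times\ell n}$ is the block-circulant matrix whose $(r,s)$ block ($0\le r,s\le n-1$) is $\mathbf{M}_{(r-s)\bmod n}$. The t-product of $\mathcal{A}\in\mathbb{C}^{m\times\ell\times n}$ and $\mathcal{B}\in\mathbb{C}^{\ell\times p\times n}$ is $\mathcal{A}\mathcal{B}=\mathrm{fold}(\mathrm{bcirc}(\mathcal{A})\,\mathrm{unfold}(\mathcal{B}))\in\mathbb{C}^{m\times p\times n}$; all tensor products are t-products. The identity tensor $\mathcal{I}\in\mathbb{C}^{m\times m\times n}$ has first frontal slice $\mathbf{I}_m$ and all other entries zero. A tensor $\mathcal{M}$ is invertible if there is $\mathcal{M}^{-1}$ with $\mathcal{M}\mathcal{M}^{-1}=\mathcal{M}^{-1}\mathcal{M}=\mathcal{I}$. The conjugate transpose $\mathcal{M}^*\in\mathbb{C}^{\ell\times m\times n}$ has $(\mathcal{M}^* )_{::0}=\mathbf{M}_0^*$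 and $(\mathcal{M}^* )_{::k}=\mathbf{M}_{n-k}^*$ for $1\le k\le n-1$. We write $\mathcal{A}_{i::}^*=(\mathcal{A}_{i::})^*$. Let $\mathbf{F}_n$ be the unitary $n\times n$ DFT matrix, $(\mathbf{F}_n)_{jk}=\frac{1}{\sqrt n}e^{-2\pi \mathrm{i} jk/n}$. For any $\mathcal{M}\in\mathbb{C}^{m\times\ell\times n}$, $\widehat{\mathcal{M}}$ is the tensor whose frontal slices $\widehat{\mathcal{M}}_0,\dots,\widehat{\mathcal{M}}_{n-1}$ are the diagonal blocks of the block-diagonal matrix $\mathrm{bdiag}(\widehat{\mathcal{M}}):=(\mathbf{F}_n\otimes\mathbf{I}_m)\,\mathrm{bcirc}(\mathcal{M})\,(\mathbf{F}_n^*\otimes\mathbf{I}_\ell)$; equivalently $\widehat{\mathcal{M}}_k=\sum_{j=0}^{n-1}e^{-2\pi\mathrm{i}jk/n}\mathbf{M}_j$. For a matrix $\mathbf{M}$ and a set $\tau$ of row indices, $\mathbf{M}_\tau$ is the submatrix of $\mathbf{M}$ with rows in $\tau$ (in increasing order), and $\mathbf{M}^\dagger$ is the Moore–Penrose pseudoinverse. *)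

theory Defs
  imports
    Complex_Main
    "Jordan_Normal_Form.Matrix"
    "Jordan_Normal_Form.Schur_Decomposition"
    "Jordan_Normal_Form.DL_Submatrix"
begin

text \<open>A third-order complex tensor is the list of its frontal slices, so that equality of
  tensors of the same size is entrywise equality. The number of rows and columns is read off the
  first slice; this is meaningful for tensors in \<open>carrier_tensor m l n\<close> with \<open>n > 0\<close>.\<close>

type_synonym tensor = "complex mat list"

definition carrier_tensor :: "nat \<Rightarrow> nat \<Rightarrow> nat \<Rightarrow> tensor set" where
  "carrier_tensor m l n = {M. length M = n \<and> set M \<subseteq> carrier_mat m l}"

definition t_rows :: "tensor \<Rightarrow> nat" where
  "t_rows M = dim_row (M ! 0)"

definition t_cols :: "tensor \<Rightarrow> nat" where
  "t_cols M = dim_col (M ! 0)"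

definition row_slice :: "tensor \<Rightarrow> nat \<Rightarrow> tensor" where
  "row_slice M i = map (\<lambda>S. mat_of_row (row S i)) M"

definition t_minus :: "tensor \<Rightarrow> tensor \<Rightarrow> tensor" where
  "t_minus A B = map2 (-) A B"


subsection \<open>The t-product\<close>

definition unfold_tensor :: "tensor \<Rightarrow> complex mat" where
  "unfold_tensor M = mat (t_rows M * length M) (t_cols M)
     (\<lambda>(r, c). (M ! (r div t_rows M)) $$ (r mod t_rows M, c))"

definition fold_tensor :: "nat \<Rightarrow> nat \<Rightarrow> complex mat \<Rightarrow> tensor" where
  "fold_tensor m n U = map (\<lambda>k. mat m (dim_col U) (\<lambda>(i, j). U $$ (k * m + i, j))) [0..<n]"

definition bcirc :: "tensor \<Rightarrow> complex mat" where
  "bcirc M = mat (t_rows M * length M) (t_cols M * length M)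
     (\<lambda>(r, c). (M ! nat ((int (r div t_rows M) - int (c div t_cols M)) mod int (length M)))
                 $$ (r mod t_rows M, c mod t_cols M))"

definition t_prod :: "tensor \<Rightarrow> tensor \<Rightarrow> tensor" where
  "t_prod A B = fold_tensor (t_rows A) (length A) (bcirc A * unfold_tensor B)"

definition t_id :: "nat \<Rightarrow> nat \<Rightarrow> tensor" where
  "t_id m n = map (\<lambda>k. if k = 0 then 1\<^sub>m m else 0\<^sub>m m m) [0..<n]"

definition t_inverse_of :: "tensor \<Rightarrow> tensor \<Rightarrow> bool" where
  "t_inverse_of M N \<longleftrightarrow>
     (\<exists>m n. M \<in> carrier_tensor m m n \<and> N \<in> carrier_tensor m m n \<and>
            t_prod M N = t_id m n \<and> t_prod N M = t_id m n)"

definition t_invertible :: "tensor \<Rightarrow> bool" where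
  "t_invertible M \<longleftrightarrow> (\<exists>N. t_inverse_of M N)"

text \<open>The inverse is unique when it exists; \<open>t_inv M\<close> is unspecified otherwise.\<close>

definition t_inv :: "tensor \<Rightarrow> tensor" where
  "t_inv M = (THE N. t_inverse_of M N)"

definition t_adjoint :: "tensor \<Rightarrow> tensor" where
  "t_adjoint M = map (\<lambda>k. if k = 0 then mat_adjoint (M ! 0)
                          else mat_adjoint (M ! (length M - k))) [0..<length M]"


subsection \<open>The Fourier domain\<close>

definition dft_mat :: "nat \<Rightarrow> complex mat" where
  "dft_mat n = mat n n (\<lambda>(j, k).
     1 / complex_of_real (sqrt (real n)) * exp (- 2 * of_real pi * \<i> * of_nat j * of_nat k / of_nat n))"

definition kronecker :: "complex mat \<Rightarrow> complex mat \<Rightarrow> complex mat" where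
  "kronecker A B = mat (dim_row A * dim_row B) (dim_col A * dim_col B)
     (\<lambda>(r, c). A $$ (r div dim_row B, c div dim_col B) * B $$ (r mod dim_row B, c mod dim_col B))"

definition fourier_bcirc :: "tensor \<Rightarrow> complex mat" where
  "fourier_bcirc M = kronecker (dft_mat (length M)) (1\<^sub>m (t_rows M)) * bcirc M
                     * kronecker (mat_adjoint (dft_mat (length M))) (1\<^sub>m (t_cols M))"

definition hat :: "tensor \<Rightarrow> tensor" where
  "hat M = map (\<lambda>k. mat (t_rows M) (t_cols M)
                   (\<lambda>(i, j). fourier_bcirc M $$ (k * t_rows M + i, k * t_cols M + j)))
               [0..<length M]"

abbreviation bdiag :: "tensor \<Rightarrow> complex mat" where
  "bdiag T \<equiv> diag_block_mat T"

text \<open>\<open>hat M\<close> reads off the diagonal blocks of \<open>fourier_bcirc M\<close>. The lemmas \<open>bdiag_hat\<close> and \<open>hat_nth\<close>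
  below show that \<open>fourier_bcirc M\<close> is indeed block diagonal with these blocks, and that
  the slices of \<open>hat M\<close> are given by the discrete Fourier transform along the third mode.\<close>

lemma carrier_tensor_dims:
  assumes "M \<in> carrier_tensor m l n" "n > 0"
  shows "length M = n" "t_rows M = m" "t_cols M = l" "\<And>k. k < n \<Longrightarrow> M ! k \<in> carrier_mat m l"
proof -
  show l: "length M = n" using assms by (simp add: carrier_tensor_def)
  show c: "M ! k \<in> carrier_mat m l" if "k < n" for k
    using assms that l unfolding carrier_tensor_def by (metis (no_types, lifting) mem_Collect_eq nth_mem subsetD)
  show "t_rows M = m" "t_cols M = l" using c[OF assms(2)] by (auto simp: t_rows_def t_cols_def)
qed

lemma diag_block_mat_index:
  fixes As :: "'a :: zero mat list"
  assumes "set As \<subseteq> carrier_mat m l" "r < m * length As" "c < l * length As"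
  shows "diag_block_mat As $$ (r, c) =
    (if r div m = c div l then (As ! (r div m)) $$ (r mod m, c mod l) else 0)"
  using assms
proof (induction As arbitrary: r c)
  case Nil
  then show ?case by simp
next
  case (Cons A As)
  have m: "m > 0" and l: "l > 0" using Cons.prems by (auto intro: Nat.gr0I)
  have A: "A \<in> carrier_mat m l" and As: "set As \<subseteq> carrier_mat m l" using Cons.prems by auto
  have d: "dim_row (diag_block_mat As) = m * length As" "dim_col (diag_block_mat As) = l * length As"
    using As by (induction As) (auto simp: Let_def)
  have rr: "r - m < m * length As" if "r \<ge> m" using Cons.prems that m by (simp add: algebra_simps)
  have cc: "c - l < l * length As" if "c \<ge> l" using Cons.prems that l by (simp add: algebra_simps)
  have e: "diag_block_mat (A # As) $$ (r, c) = (if r < m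
      then if c < l then A $$ (r, c) else 0
      else if c < l then 0 else diag_block_mat As $$ (r - m, c - l))"
    using Cons.prems A d rr cc by (auto simp: Let_def)
  have divr: "r div m = Suc ((r - m) div m)" "r mod m = (r - m) mod m" if "r \<ge> m"
    using m that by (auto simp: le_div_geq le_mod_geq)
  have divc: "c div l = Suc ((c - l) div l)" "c mod l = (c - l) mod l" if "c \<ge> l"
    using l that by (auto simp: le_div_geq le_mod_geq)
  show ?case
    unfolding e using Cons.IH[OF As rr cc] m l divr divc by (auto simp: not_less)
qed

lemma block_index_bound:
  fixes i k m n :: nat
  assumes "i < m" "k < n"
  shows "k * m + i < m * n"
proof -
  have "k * m + i < Suc k * m" using assms by simp
  also have "\<dots> \<le> n * m" using assms by (intro mult_le_mono1) simp
  finally show ?thesis by (simp add: mult.commute)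
qed

lemma shift_mod:
  fixes b t n :: nat
  assumes "b < n" "t < n"
  shows "((b + t) mod n + n - t) mod n = b"
proof (cases "b + t < n")
  case True
  then have "(b + t) mod n + n - t = b + n" by simp
  then show ?thesis using assms by simp
next
  case False
  then have "(b + t) mod n = b + t - n" using assms by (simp add: le_mod_geq)
  then have "(b + t) mod n + n - t = b" using False by simp
  then show ?thesis using assms by simp
qed

lemma cis_powi_minus: "cis x powi (- int k) = cis (- (x * real k))"
  by (simp only: power_int_minus power_int_of_nat Complex.DeMoivre cis_inverse mult.commute)

lemma sum_div_mod:
  fixes f :: "nat \<Rightarrow> nat \<Rightarrow> complex"
  assumes "a > 0"
  shows "(\<Sum>x = 0..<a * n. f (x div a) (x mod a)) = (\<Sum>k<n. \<Sum>i<a. f k i)"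
proof -
  have div_less: "x div a < n" if "x < a * n" for x
    using that by (simp add: less_mult_imp_div_less mult.commute)
  have "(\<Sum>k<n. \<Sum>i<a. f k i) = (\<Sum>(k,i) \<in> {..<n} \<times> {..<a}. f k i)"
    by (simp add: sum.cartesian_product)
  also have "\<dots> = (\<Sum>x = 0..<a * n. f (x div a) (x mod a))"
    by (rule sum.reindex_bij_witness[of _ "\<lambda>x. (x div a, x mod a)" "\<lambda>(k,i). k * a + i"])
       (use assms in \<open>auto simp: block_index_bound div_less\<close>)
  finally show ?thesis by simp
qed

lemma dft_mat_index:
  assumes "j < n" "k < n"
  shows "dft_mat n $$ (j, k) = cis (2 * pi / n) powi (- int (j * k)) / sqrt n"
proof -
  have "exp (- 2 * of_real pi * \<i> * of_nat j * of_nat k / of_nat n) = cis (- (2 * pi / n * (j * k)))"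
    unfolding cis_conv_exp by (simp add: algebra_simps)
  also have "\<dots> = cis (2 * pi / n) powi (- int (j * k))"
    unfolding cis_powi_minus by (simp add: mult.commute)
  finally show ?thesis using assms by (simp add: dft_mat_def)
qed

lemma dft_adjoint_index:
  assumes "j < n" "k < n"
  shows "mat_adjoint (dft_mat n) $$ (j, k) = cis (2 * pi / n) ^ (j * k) / sqrt n"
proof -
  have "mat_adjoint (dft_mat n) $$ (j, k) = cnj (dft_mat n $$ (k, j))"
    using assms unfolding mat_adjoint_def by (simp add: mat_of_rows_def dft_mat_def)
  also have "\<dots> = cis (2 * pi / n) ^ (j * k) / sqrt n"
    unfolding dft_mat_index[OF assms(2,1)]
    unfolding cis_powi_minus by (simp add: cis_cnj Complex.DeMoivre mult_ac)
  finally show ?thesis .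
qed

lemma root_sum:
  assumes "k < n" "k' < n"
  defines "v \<equiv> cis (2 * pi / n)"
  shows "(\<Sum>s<n. v powi (- int (k * s)) * v ^ (s * k')) = (if k = k' then of_nat n else 0)"
proof -
  have v0: "v \<noteq> 0" by (simp add: v_def)
  define q where "q = v ^ k' / v ^ k"
  have vn: "v ^ n = 1" using assms by (simp add: v_def Complex.DeMoivre)
  have "q ^ n = (v ^ n) ^ k' / (v ^ n) ^ k"
    by (simp add: q_def power_divide flip: power_mult) (simp add: mult.commute)
  then have qn: "q ^ n = 1" using vn by simp
  have inj: "inj_on (\<lambda>k. cis (2 * pi * real k / real n)) {..<n}"
    using bij_betw_roots_unity[of n] assms by (auto simp: bij_betw_def)
  have vk: "v ^ j = cis (2 * pi * real j / real n)" for j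
    by (simp add: v_def Complex.DeMoivre mult.commute)
  have q1: "q = 1 \<longleftrightarrow> k = k'"
    using inj_onD[OF inj, of k k'] assms v0 unfolding q_def vk[symmetric] by auto
  have qs: "v powi (- int (k * s)) * v ^ (s * k') = q ^ s" for s
  proof -
    have "v powi (- int (k * s)) = inverse (v ^ (k * s))"
      by (simp only: power_int_minus power_int_of_nat)
    moreover have "q ^ s = v ^ (k' * s) / v ^ (k * s)"
      by (simp only: q_def power_divide power_mult)
    ultimately show ?thesis by (simp only: divide_inverse mult.commute)
  qed
  have "(\<Sum>s<n. v powi (- int (k * s)) * v ^ (s * k')) = (\<Sum>s<n. q ^ s)"
    by (simp only: qs)
  also have "\<dots> = (if k = k' then of_nat n else 0)"
    using q1 qn by (auto simp: sum_gp_strict)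
  finally show ?thesis .
qed

lemma dim_fourier_bcirc:
  assumes "M \<in> carrier_tensor m l n" "n > 0"
  shows "fourier_bcirc M \<in> carrier_mat (m * n) (l * n)"
  using carrier_tensor_dims[OF assms]
  by (auto simp: fourier_bcirc_def kronecker_def dft_mat_def mat_adjoint_def)

lemma powi_mod:
  assumes "n > 0"
  shows "cis (2 * pi / n) powi (a mod int n) = cis (2 * pi / n) powi a"
proof -
  have vn: "cis (2 * pi / n) ^ n = 1" using assms by (simp add: Complex.DeMoivre)
  have "cis (2 * pi / n) powi a = cis (2 * pi / n) powi (int n * (a div int n) + a mod int n)" by simp
  also have "\<dots> = (cis (2 * pi / n) powi int n) powi (a div int n) * cis (2 * pi / n) powi (a mod int n)"
    by (subst power_int_add) (auto simp: power_int_mult)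
  also have "\<dots> = cis (2 * pi / n) powi (a mod int n)" using vn by simp
  finally show ?thesis by simp
qed

lemma fourier_bcirc_index:
  assumes M: "M \<in> carrier_tensor m l n" "n > 0"
    and "r < m * n" "c < l * n"
  shows "fourier_bcirc M $$ (r, c) =
    (if r div m = c div l
     then \<Sum>j<n. exp (- 2 * of_real pi * \<i> * of_nat j * of_nat (r div m) / of_nat n)
                   * (M ! j) $$ (r mod m, c mod l)
     else 0)"
proof -
  note d = carrier_tensor_dims[OF M]
  define v where "v = cis (2 * pi / n)"
  have v0: "v \<noteq> 0" by (simp add: v_def)
  define k where "k = r div m"
  define k' where "k' = c div l"
  define i where "i = r mod m"
  define j where "j = c mod l"
  have ml: "m > 0" "l > 0" using assms by (auto intro: Nat.gr0I)
  have kk: "k < n" "k' < n" "i < m" "j < l"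
    using assms ml by (auto simp: k_def k'_def i_def j_def less_mult_imp_div_less mult.commute)
  let ?K = "kronecker (dft_mat n) (1\<^sub>m m)"
  let ?L = "kronecker (mat_adjoint (dft_mat n)) (1\<^sub>m l)"
  have dims: "dim_row ?K = m * n" "dim_col ?K = m * n" "dim_row (bcirc M) = m * n" "dim_col (bcirc M) = l * n"
    "dim_row ?L = l * n" "dim_col ?L = l * n"
    by (auto simp: kronecker_def dft_mat_def bcirc_def d mat_adjoint_def)
  have divm: "x div m < n" "x mod m < m" if "x < m * n" for x
    using that ml by (auto simp: less_mult_imp_div_less mult.commute)
  have divl: "x div l < n" "x mod l < l" if "x < l * n" for x
    using that ml by (auto simp: less_mult_imp_div_less mult.commute)
  have md: "dim_row (dft_mat n) = n" "dim_col (dft_mat n) = n"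
     "dim_row (mat_adjoint (dft_mat n)) = n" "dim_col (mat_adjoint (dft_mat n)) = n"
    by (auto simp: dft_mat_def mat_adjoint_def)
  have K: "?K $$ (r, x) = v powi (- int (k * (x div m))) / sqrt n * (if x mod m = i then 1 else 0)"
    if "x < m * n" for x
    using that assms ml divm[OF that] kk
    by (auto simp: kronecker_def md dft_mat_index k_def i_def v_def mult.commute)
  have L: "?L $$ (y, c) = v ^ ((y div l) * k') / sqrt n * (if y mod l = j then 1 else 0)"
    if "y < l * n" for y
    using that assms ml divl[OF that] kk
    by (auto simp: kronecker_def md dft_adjoint_index k'_def j_def v_def mult.commute)
  define G where "G = (\<lambda>u::int. (M ! nat (u mod int n)) $$ (i, j))"
  have KB: "(?K * bcirc M) $$ (r, y) =
      (\<Sum>s<n. v powi (- int (k * s)) / sqrt n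
          * (M ! nat ((int s - int (y div l)) mod int n)) $$ (i, y mod l))"
    if y: "y < l * n" for y
  proof -
    have "(?K * bcirc M) $$ (r, y) = (\<Sum>x = 0..<m * n. ?K $$ (r, x) * bcirc M $$ (x, y))"
      using assms y dims by (simp add: scalar_prod_def)
    also have "\<dots> = (\<Sum>x = 0..<m * n. (\<lambda>s a. v powi (- int (k * s)) / sqrt n * (if a = i then 1 else 0)
       * (M ! nat ((int s - int (y div l)) mod int n)) $$ (a, y mod l)) (x div m) (x mod m))"
      by (rule sum.cong) (use y in \<open>auto simp: K bcirc_def d\<close>)
    also have "\<dots> = (\<Sum>s<n. \<Sum>a<m. v powi (- int (k * s)) / sqrt n * (if a = i then 1 else 0)
       * (M ! nat ((int s - int (y div l)) mod int n)) $$ (a, y mod l))"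
      by (rule sum_div_mod[OF ml(1)])
    also have "\<dots> = (\<Sum>s<n. v powi (- int (k * s)) / sqrt n
          * (M ! nat ((int s - int (y div l)) mod int n)) $$ (i, y mod l))"
      using kk by (intro sum.cong) (auto simp: if_distrib if_distribR cong: if_cong)
    finally show ?thesis .
  qed
  have "fourier_bcirc M $$ (r, c) = (\<Sum>y = 0..<l * n. (?K * bcirc M) $$ (r, y) * ?L $$ (y, c))"
    using assms dims unfolding fourier_bcirc_def by (simp add: scalar_prod_def d)
  also have "\<dots> = (\<Sum>y = 0..<l * n. (\<lambda>t b. (\<Sum>s<n. v powi (- int (k * s)) / sqrt n
          * (M ! nat ((int s - int t) mod int n)) $$ (i, b))
          * (v ^ (t * k') / sqrt n * (if b = j then 1 else 0))) (y div l) (y mod l))"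
    by (rule sum.cong) (auto simp: KB L)
  also have "\<dots> = (\<Sum>t<n. \<Sum>b<l. (\<Sum>s<n. v powi (- int (k * s)) / sqrt n
          * (M ! nat ((int s - int t) mod int n)) $$ (i, b))
          * (v ^ (t * k') / sqrt n * (if b = j then 1 else 0)))"
    by (rule sum_div_mod[OF ml(2)])
  also have "\<dots> = (\<Sum>t<n. (\<Sum>s<n. v powi (- int (k * s)) / sqrt n
          * G (int s - int t)) * (v ^ (t * k') / sqrt n))"
    using kk unfolding G_def by (intro sum.cong) (auto simp: if_distrib if_distribR cong: if_cong)
  also have "\<dots> = (\<Sum>t<n. (\<Sum>u<n. v powi (- int (k * u)) * G (int u))
                        * (v powi (- int (k * t)) * v ^ (t * k') / of_nat n))"
  proof (rule sum.cong, rule refl)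
    fix t assume "t \<in> {..<n}"
    then have t: "t < n" by simp
    have "(\<Sum>s<n. v powi (- int (k * s)) * G (int s - int t))
        = (\<Sum>u<n. v powi (- int (k * ((u + t) mod n))) * G (int ((u + t) mod n) - int t))"
      by (rule sum.reindex_bij_witness[of _ "\<lambda>u. (u + t) mod n" "\<lambda>s. (s + (n - t)) mod n"])
         (use t in \<open>auto simp: mod_simps\<close>, simp add: shift_mod)
    also have "\<dots> = (\<Sum>u<n. v powi (- int (k * u)) * G (int u) * v powi (- int (k * t)))"
    proof (rule sum.cong, rule refl)
      fix u assume "u \<in> {..<n}"
      have g: "G (int ((u + t) mod n) - int t) = G (int u)"
        unfolding G_def by (simp add: zmod_int mod_simps)
      have "v powi (- int (k * ((u + t) mod n))) = v powi ((- int (k * ((u + t) mod n))) mod int n)"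
        unfolding v_def using M(2) by (simp add: powi_mod)
      also have "(- int (k * ((u + t) mod n))) mod int n = (- int (k * (u + t))) mod int n"
        unfolding of_nat_mult zmod_int by (metis mod_minus_eq mod_mult_right_eq)
      also have "v powi \<dots> = v powi (- int (k * (u + t)))"
        unfolding v_def using M(2) by (simp add: powi_mod)
      also have "\<dots> = v powi (- int (k * u)) * v powi (- int (k * t))"
      proof -
        have "- int (k * (u + t)) = - int (k * u) + - int (k * t)" by (simp add: distrib_left)
        then show ?thesis using power_int_add[of v "- int (k * u)" "- int (k * t)"] v0 by metis
      qed
      finally show "v powi (- int (k * ((u + t) mod n))) * G (int ((u + t) mod n) - int t)
          = v powi (- int (k * u)) * G (int u) * v powi (- int (k * t))" using g by simp
    qed
    finally have e: "(\<Sum>s<n. v powi (- int (k * s)) * G (int s - int t))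
       = (\<Sum>u<n. v powi (- int (k * u)) * G (int u)) * v powi (- int (k * t))"
      by (simp add: sum_distrib_right)
    have sq: "complex_of_real (sqrt n) * complex_of_real (sqrt n) = of_nat n"
      by (simp flip: of_real_mult)
    have "(\<Sum>s<n. v powi (- int (k * s)) / sqrt n * G (int s - int t)) * (v ^ (t * k') / sqrt n)
      = (\<Sum>s<n. v powi (- int (k * s)) * G (int s - int t)) * v ^ (t * k') / (complex_of_real (sqrt n) * complex_of_real (sqrt n))"
      by (simp add: sum_distrib_left sum_distrib_right sum_divide_distrib mult_ac)
    then show "(\<Sum>s<n. v powi (- int (k * s)) / sqrt n * G (int s - int t)) * (v ^ (t * k') / sqrt n)
      = (\<Sum>u<n. v powi (- int (k * u)) * G (int u))
                        * (v powi (- int (k * t)) * v ^ (t * k') / of_nat n)"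
      unfolding sq e by (simp add: mult_ac)
  qed
  also have "\<dots> = (\<Sum>u<n. v powi (- int (k * u)) * G (int u))
        * ((\<Sum>t<n. v powi (- int (k * t)) * v ^ (t * k')) / of_nat n)"
    by (simp only: sum_distrib_left sum_divide_distrib)
  also have "\<dots> = (if k = k' then \<Sum>u<n. v powi (- int (k * u)) * G (int u) else 0)"
    using M(2) root_sum[OF kk(1,2)] by (simp add: v_def)
  also have "(\<Sum>u<n. v powi (- int (k * u)) * G (int u)) =
     (\<Sum>u<n. exp (- 2 * of_real pi * \<i> * of_nat u * of_nat k / of_nat n) * (M ! u) $$ (i, j))"
  proof (rule sum.cong, rule refl)
    fix u assume u: "u \<in> {..<n}"
    have "exp (- 2 * of_real pi * \<i> * of_nat u * of_nat k / of_nat n) = cis (- (2 * pi / n * (k * u)))"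
      unfolding cis_conv_exp by (simp add: algebra_simps)
    also have "\<dots> = v powi (- int (k * u))" unfolding v_def
      unfolding cis_powi_minus by simp
    finally show "v powi (- int (k * u)) * G (int u) =
     exp (- 2 * of_real pi * \<i> * of_nat u * of_nat k / of_nat n) * (M ! u) $$ (i, j)"
      using u by (simp add: G_def)
  qed
  finally show ?thesis unfolding k_def k'_def i_def j_def .
qed

lemma bdiag_hat:
  assumes "M \<in> carrier_tensor m l n" "n > 0"
  shows "bdiag (hat M) = fourier_bcirc M"
proof -
  note d = carrier_tensor_dims[OF assms] and f = dim_fourier_bcirc[OF assms]
  have h: "set (hat M) \<subseteq> carrier_mat m l" "length (hat M) = n"
    by (auto simp: hat_def d)
  have dd: "dim_row (bdiag (hat M)) = m * n" "dim_col (bdiag (hat M)) = l * n"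
    by (simp_all add: dim_diag_block_mat hat_def d o_def sum_list_triv)
  show ?thesis
  proof (rule eq_matI)
    fix r c assume "r < dim_row (fourier_bcirc M)" "c < dim_col (fourier_bcirc M)"
    then have rc: "r < m * n" "c < l * n" using f by auto
    then have ml: "m > 0" "l > 0" by (auto intro: Nat.gr0I)
    have q: "r div m < n" "c div l < n" using rc by (auto simp: less_mult_imp_div_less mult.commute)
    have e: "bdiag (hat M) $$ (r, c) = (if r div m = c div l then (hat M ! (r div m)) $$ (r mod m, c mod l) else 0)"
      by (rule diag_block_mat_index) (use h rc in auto)
    show "bdiag (hat M) $$ (r, c) = fourier_bcirc M $$ (r, c)"
    proof (cases "r div m = c div l")
      case True
      have "(hat M ! (r div m)) $$ (r mod m, c mod l)
          = fourier_bcirc M $$ ((r div m) * m + r mod m, (r div m) * l + c mod l)"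
        using q(1) ml by (simp add: hat_def d)
      also have "\<dots> = fourier_bcirc M $$ (r, c)"
        unfolding div_mult_mod_eq by (simp only: True div_mult_mod_eq)
      finally show ?thesis using e True by simp
    next
      case False
      then show ?thesis using e fourier_bcirc_index[OF assms rc] by simp
    qed
  qed (use f dd in auto)
qed

lemma hat_nth:
  assumes "M \<in> carrier_tensor m l n" "k < n" "i < m" "j < l"
  shows "(hat M ! k) $$ (i, j) =
    (\<Sum>s<n. exp (- 2 * of_real pi * \<i> * of_nat s * of_nat k / of_nat n) * (M ! s) $$ (i, j))"
proof -
  have n: "n > 0" using assms by simp
  have rc: "k * m + i < m * n" "k * l + j < l * n"
    using assms by (simp_all add: block_index_bound)
  show ?thesis using assms fourier_bcirc_index[OF assms(1) n rc]
    by (simp add: hat_def carrier_tensor_dims[OF assms(1) n])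
qed


subsection \<open>Kaczmarz iterations\<close>

definition row_submat :: "complex mat \<Rightarrow> nat set \<Rightarrow> complex mat" where
  "row_submat M \<tau> = submatrix M \<tau> UNIV"

text \<open>The four Penrose equations; they have exactly one solution for every complex matrix.\<close>

definition is_pinv :: "complex mat \<Rightarrow> complex mat \<Rightarrow> bool" where
  "is_pinv M P \<longleftrightarrow>
     P \<in> carrier_mat (dim_col M) (dim_row M) \<and>
     M * P * M = M \<and> P * M * P = P \<and>
     mat_adjoint (M * P) = M * P \<and> mat_adjoint (P * M) = P * M"

definition pinv :: "complex mat \<Rightarrow> complex mat" where
  "pinv M = (THE P. is_pinv M P)"

primrec tensor_kaczmarz :: "tensor \<Rightarrow> tensor \<Rightarrow> (nat \<Rightarrow> nat) \<Rightarrow> tensor \<Rightarrow> nat \<Rightarrow> tensor" where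
  "tensor_kaczmarz A B idx X0 0 = X0"
| "tensor_kaczmarz A B idx X0 (Suc t) =
     (let X = tensor_kaczmarz A B idx X0 t;
          Ai = row_slice A (idx t);
          Bi = row_slice B (idx t)
      in t_minus X
           (t_prod (t_prod (t_adjoint Ai) (t_inv (t_prod Ai (t_adjoint Ai))))
                   (t_minus (t_prod Ai X) Bi)))"

primrec block_kaczmarz ::
  "complex mat \<Rightarrow> complex mat \<Rightarrow> (nat \<Rightarrow> nat set) \<Rightarrow> complex mat \<Rightarrow> nat \<Rightarrow> complex mat" where
  "block_kaczmarz M R \<tau> Y0 0 = Y0"
| "block_kaczmarz M R \<tau> Y0 (Suc t) =
     (let Y = block_kaczmarz M R \<tau> Y0 t
      in Y - pinv (row_submat M (\<tau> t)) * (row_submat M (\<tau> t) * Y - row_submat R (\<tau> t)))"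

definition kaczmarz_block :: "nat \<Rightarrow> nat \<Rightarrow> nat \<Rightarrow> nat set" where
  "kaczmarz_block m n i = {k * m + i | k. k < n}"

end

theory Submission
  imports Defs
begin

text \<open>The Fourier transform along the third mode turns the t-product into slicewise matrix products,
  so \<open>bdiag \<circ> hat\<close> and \<open>unfold_tensor \<circ> hat\<close> carry the algebra of tensors over to that of matrices, and the
  block \<open>\<tau>\<^sub>i\<close> of rows of \<open>bdiag (hat A)\<close> is exactly \<open>D = bdiag (hat (row_slice A i))\<close>. Invertibility
  of \<open>row_slice A i\<close> times its adjoint makes \<open>D D\<^sup>*\<close> invertible, hence the pseudoinverse of \<open>D\<close> is
  \<open>D\<^sup>* (D D\<^sup>*)\<^sup>-\<^sup>1\<close>, which is the image of the tensor factor in the tensor iteration.\<close>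

section \<open>Entrywise equality of tensors and block indices\<close>

lemma carrier_tensorI:
  assumes "length M = n" "\<And>k. k < n \<Longrightarrow> M ! k \<in> carrier_mat m l"
  shows "M \<in> carrier_tensor m l n"
  using assms by (auto simp: carrier_tensor_def in_set_conv_nth)

lemma carrier_tensorD:
  assumes "M \<in> carrier_tensor m l n"
  shows "length M = n" "\<And>k. k < n \<Longrightarrow> M ! k \<in> carrier_mat m l"
  using assms by (auto simp: carrier_tensor_def)

lemma tensor_eqI:
  assumes "M \<in> carrier_tensor m l n" "N \<in> carrier_tensor m l n"
    and "\<And>k i j. k < n \<Longrightarrow> i < m \<Longrightarrow> j < l \<Longrightarrow> (M ! k) $$ (i, j) = (N ! k) $$ (i, j)"
  shows "M = N"
proof (rule nth_equalityI)
  show "length M = length N" using assms by (simp add: carrier_tensor_def)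
  fix k assume "k < length M"
  then have k: "k < n" using assms(1) by (simp add: carrier_tensor_def)
  show "M ! k = N ! k"
    using carrier_tensorD(2)[OF assms(1) k] carrier_tensorD(2)[OF assms(2) k] assms(3)[OF k]
    by (intro eq_matI) auto
qed

lemma div_mod_bound:
  fixes r m n :: nat
  assumes "r < m * n"
  shows "r div m < n" "r mod m < m"
proof -
  have "m > 0" using assms by (auto intro: Nat.gr0I)
  then show "r div m < n" "r mod m < m"
    using assms by (auto simp: less_mult_imp_div_less mult.commute)
qed

text \<open>Quotient and remainder by \<open>a\<close> identify an index below \<open>a * n\<close>
  with a pair of block and offset. The case \<open>a = 0\<close>, where both sides vanish, is
  included so that empty dimensions need no separate treatment later.\<close>

lemma sum_blocks:
  fixes f :: "nat \<Rightarrow> nat \<Rightarrow> complex"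
  shows "(\<Sum>x = 0..<a * n. f (x div a) (x mod a)) = (\<Sum>k<n. \<Sum>i<a. f k i)"
  by (cases "a = 0") (auto simp: sum_div_mod)


section \<open>Adjoints and pseudoinverses\<close>

lemma mat_adjoint_carrier [simp]:
  "A \<in> carrier_mat m n \<Longrightarrow> mat_adjoint A \<in> carrier_mat n m"
  by (auto simp: mat_adjoint_def)

lemma mat_adjoint_index:
  fixes A :: "complex mat"
  assumes "A \<in> carrier_mat m n" "i < n" "j < m"
  shows "mat_adjoint A $$ (i, j) = cnj (A $$ (j, i))"
  using assms by (auto simp: mat_adjoint_def mat_of_rows_def)

lemma mat_adjoint_adjoint:
  fixes A :: "complex mat"
  assumes "A \<in> carrier_mat m n"
  shows "mat_adjoint (mat_adjoint A) = A"
proof (rule eq_matI)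
  have c: "mat_adjoint (mat_adjoint A) \<in> carrier_mat m n" using assms by simp
  show "dim_row (mat_adjoint (mat_adjoint A)) = dim_row A"
    "dim_col (mat_adjoint (mat_adjoint A)) = dim_col A"
    using carrier_matD[OF c] carrier_matD[OF assms] by simp_all
  fix i j assume "i < dim_row A" "j < dim_col A"
  then have ij: "i < m" "j < n" using assms by auto
  then show "mat_adjoint (mat_adjoint A) $$ (i, j) = A $$ (i, j)"
    by (simp add: mat_adjoint_index[OF mat_adjoint_carrier[OF assms] ij] mat_adjoint_index[OF assms ij(2,1)])
qed

lemma mat_adjoint_mult:
  fixes A B :: "complex mat"
  assumes A: "A \<in> carrier_mat m n" and B: "B \<in> carrier_mat n p"
  shows "mat_adjoint (A * B) = mat_adjoint B * mat_adjoint A"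
proof (rule eq_matI)
  have C: "A * B \<in> carrier_mat m p" using A B by simp
  note cs = mat_adjoint_carrier[OF C] mat_adjoint_carrier[OF A] mat_adjoint_carrier[OF B]
  show "dim_row (mat_adjoint (A * B)) = dim_row (mat_adjoint B * mat_adjoint A)"
    "dim_col (mat_adjoint (A * B)) = dim_col (mat_adjoint B * mat_adjoint A)" using cs by auto
  fix i j assume "i < dim_row (mat_adjoint B * mat_adjoint A)" "j < dim_col (mat_adjoint B * mat_adjoint A)"
  then have ij: "i < p" "j < m" using cs by auto
  then have "mat_adjoint (A * B) $$ (i, j) = (\<Sum>k = 0..<n. cnj (A $$ (j, k)) * cnj (B $$ (k, i)))"
    using A B by (simp add: mat_adjoint_index[OF C] scalar_prod_def)
  also have "\<dots> = (\<Sum>k = 0..<n. mat_adjoint B $$ (i, k) * mat_adjoint A $$ (k, j))"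
    using ij by (intro sum.cong) (auto simp: mat_adjoint_index[OF A] mat_adjoint_index[OF B])
  also have "\<dots> = (mat_adjoint B * mat_adjoint A) $$ (i, j)"
    using ij cs by (simp add: scalar_prod_def)
  finally show "mat_adjoint (A * B) $$ (i, j) = (mat_adjoint B * mat_adjoint A) $$ (i, j)" .
qed

lemma mat_adjoint_one: "mat_adjoint (1\<^sub>m n :: complex mat) = 1\<^sub>m n"
  by (rule eq_matI) (auto simp: mat_adjoint_def mat_of_rows_def)

text \<open>Penrose's argument: the orthogonal projections \<open>M * P\<close> and
  \<open>M * Q\<close> coincide, and so do \<open>P * M\<close> and \<open>Q * M\<close>. Hence P =
  P M P = Q M P = Q M Q = Q.\<close>

lemma is_pinv_unique:
  assumes "is_pinv M P" "is_pinv M Q"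
  shows "P = Q"
proof -
  obtain r c where M: "M \<in> carrier_mat r c" by (meson carrier_matI)
  have P: "P \<in> carrier_mat c r" and Q: "Q \<in> carrier_mat c r"
    using assms M by (auto simp: is_pinv_def)
  have p: "M * P * M = M" "P * M * P = P" "mat_adjoint (M * P) = M * P" "mat_adjoint (P * M) = P * M"
    and q: "M * Q * M = M" "Q * M * Q = Q" "mat_adjoint (M * Q) = M * Q" "mat_adjoint (Q * M) = Q * M"
    using assms by (auto simp: is_pinv_def)
  have MP: "M * P \<in> carrier_mat r r" and MQ: "M * Q \<in> carrier_mat r r"
    and PM: "P * M \<in> carrier_mat c c" and QM: "Q * M \<in> carrier_mat c c"
    using M P Q by auto
  \<comment> \<open>\<open>M P\<close> and \<open>M Q\<close> are Hermitian, so taking adjoints swaps the factors in \<open>M P = M Q M P\<close>.\<close>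
  have "M * P = M * Q * (M * P)"
    using q(1) assoc_mult_mat[OF MQ M P] by simp
  then have "M * P = mat_adjoint (M * Q * (M * P))" using p(3) by simp
  also have "\<dots> = M * P * (M * Q)"
    using mat_adjoint_mult[OF MQ MP] p(3) q(3) by simp
  also have "\<dots> = M * Q"
    using p(1) assoc_mult_mat[OF MP M Q] by simp
  finally have 1: "M * P = M * Q" .
  \<comment> \<open>The mirror image: \<open>M\<close> is expanded as \<open>M * Q * M\<close> on
    the right, and the adjoint reverses the Hermitian factors \<open>P * M\<close> and
    \<open>Q * M\<close>.\<close>
  have "P * M = P * M * (Q * M)"
    using q(1) assoc_mult_mat[OF P M QM] assoc_mult_mat[OF M Q M] by simp
  then have "P * M = mat_adjoint (P * M * (Q * M))" using p(4) by simp
  also have "\<dots> = Q * M * (P * M)"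
    using mat_adjoint_mult[OF PM QM] p(4) q(4) by simp
  also have "\<dots> = Q * M"
    using p(1) assoc_mult_mat[OF Q M PM] assoc_mult_mat[OF M P M] by simp
  finally have 2: "P * M = Q * M" .
  have "P = Q * M * P" using p(2) 2 by simp
  also have "\<dots> = Q * M * Q" using 1 assoc_mult_mat[OF Q M P] assoc_mult_mat[OF Q M Q] by simp
  finally show ?thesis using q(2) by simp
qed

text \<open>As \<open>pinv\<close> is a definite description, uniqueness identifies it with any
  explicit solution of the Penrose equations.\<close>

lemma pinv_eqI: "is_pinv M P \<Longrightarrow> pinv M = P"
  unfolding pinv_def using is_pinv_unique by (intro the_equality)

text \<open>The candidate P is a right inverse of \<open>D\<close>, which settles every Penrose
  equation except that P D is Hermitian. For the latter, \<open>H\<close> has to be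
  Hermitian.\<close>

lemma pinv_full_row_rank:
  fixes D H :: "complex mat"
  assumes D: "D \<in> carrier_mat r c" and H: "H \<in> carrier_mat r r"
    and inv: "D * mat_adjoint D * H = 1\<^sub>m r"
  shows "pinv D = mat_adjoint D * H"
proof (rule pinv_eqI)
  let ?S = "mat_adjoint D" and ?G = "D * mat_adjoint D"
  have S: "?S \<in> carrier_mat c r" using D by simp
  have G: "?G \<in> carrier_mat r r" using D S by simp
  have Hs: "mat_adjoint H \<in> carrier_mat r r" using H by simp
  have P: "?S * H \<in> carrier_mat c r" using S H by simp
  have Gs: "mat_adjoint ?G = ?G"
    using mat_adjoint_mult[OF D S] mat_adjoint_adjoint[OF D] by simp
  \<comment> \<open>\<open>H\<close> is given only as a right inverse of the Hermitian matrix
    \<open>?G\<close>. Its adjoint is then a left inverse, and a left and a right inverse agree, so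
    \<open>H\<close> equals its adjoint.\<close>
  have "mat_adjoint H * ?G = 1\<^sub>m r"
    using mat_adjoint_mult[OF G H] inv Gs mat_adjoint_one by metis
  then have "mat_adjoint H * ?G * H = H" using H by simp
  then have herm: "mat_adjoint H = H"
    using assoc_mult_mat[OF Hs G H] inv Hs by simp
  have DP: "D * (?S * H) = 1\<^sub>m r" using assoc_mult_mat[OF D S H] inv by simp
  have "mat_adjoint (?S * H * D) = ?S * mat_adjoint (?S * H)"
    by (rule mat_adjoint_mult[OF P D])
  also have "\<dots> = ?S * (H * D)"
    using mat_adjoint_mult[OF S H] mat_adjoint_adjoint[OF D] herm by simp
  also have "\<dots> = ?S * H * D" using assoc_mult_mat[OF S H D] by simp
  finally have PD: "mat_adjoint (?S * H * D) = ?S * H * D" .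
  have "?S * H * D * (?S * H) = ?S * H"
    using assoc_mult_mat[OF P D P] DP right_mult_one_mat[OF P] by simp
  then show "is_pinv D (?S * H)"
    unfolding is_pinv_def using P D DP PD mat_adjoint_one by simp
qed


section \<open>Block-diagonal matrices\<close>

lemma bdiag_carrier:
  assumes "M \<in> carrier_tensor m l n"
  shows "bdiag M \<in> carrier_mat (m * n) (l * n)"
proof -
  have "set M \<subseteq> carrier_mat m l" "length M = n" using assms by (auto simp: carrier_tensor_def)
  then show ?thesis
    by (induction M arbitrary: n) (auto simp: Let_def)
qed

lemma bdiag_index:
  assumes "M \<in> carrier_tensor m l n" "r < m * n" "c < l * n"
  shows "bdiag M $$ (r, c) =
    (if r div m = c div l then (M ! (r div m)) $$ (r mod m, c mod l) else 0)"
  using assms diag_block_mat_index[of M m l r c] by (auto simp: carrier_tensor_def)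

lemma unfold_carrier:
  assumes "M \<in> carrier_tensor m l n" "n > 0"
  shows "unfold_tensor M \<in> carrier_mat (m * n) l"
  using carrier_tensor_dims[OF assms] by (simp add: unfold_tensor_def)

lemma unfold_index:
  assumes "M \<in> carrier_tensor m l n" "r < m * n" "c < l"
  shows "unfold_tensor M $$ (r, c) = (M ! (r div m)) $$ (r mod m, c)"
proof -
  have "n > 0" using assms by (auto intro: Nat.gr0I)
  then show ?thesis using carrier_tensor_dims[OF assms(1)] assms by (simp add: unfold_tensor_def)
qed

lemma map2_times_carrier:
  assumes "M \<in> carrier_tensor m l n" "N \<in> carrier_tensor l p n"
  shows "map2 (*) M N \<in> carrier_tensor m p n"
proof (rule carrier_tensorI)
  fix k assume "k < n"
  then show "map2 (*) M N ! k \<in> carrier_mat m p"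
    using carrier_tensorD[OF assms(1)] carrier_tensorD[OF assms(2)] by (auto intro: mult_carrier_mat)
qed (use assms in \<open>simp add: carrier_tensor_def\<close>)

lemma map2_times_index:
  assumes "M \<in> carrier_tensor m l n" "N \<in> carrier_tensor l p n" "k < n" "i < m" "j < p"
  shows "(map2 (*) M N ! k) $$ (i, j) = (\<Sum>a<l. (M ! k) $$ (i, a) * (N ! k) $$ (a, j))"
  using carrier_tensorD(1)[OF assms(1)] carrier_tensorD(1)[OF assms(2)]
    carrier_tensorD(2)[OF assms(1,3)] carrier_tensorD(2)[OF assms(2,3)] assms(3-)
  by (simp add: scalar_prod_def atLeast0LessThan)

text \<open>Write the inner index as block \<open>k\<close> and offset \<open>a\<close>. The left
  factor forces \<open>k\<close> to be the row block of \<open>r\<close>, the right factor forces it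
  to be the column block of \<open>s\<close>; so off-diagonal blocks vanish and diagonal blocks
  multiply.\<close>

lemma bdiag_mult:
  assumes M: "M \<in> carrier_tensor m l n" and N: "N \<in> carrier_tensor l p n"
  shows "bdiag (map2 (*) M N) = bdiag M * bdiag N"
proof (rule eq_matI)
  note MN = map2_times_carrier[OF M N]
  note c = bdiag_carrier[OF M] bdiag_carrier[OF N] bdiag_carrier[OF MN]
  fix r s assume "r < dim_row (bdiag M * bdiag N)" "s < dim_col (bdiag M * bdiag N)"
  then have rs: "r < m * n" "s < p * n" using c by auto
  have "(bdiag M * bdiag N) $$ (r, s) = (\<Sum>x = 0..<l * n. bdiag M $$ (r, x) * bdiag N $$ (x, s))"
    using c rs by (simp add: scalar_prod_def)
  \<comment> \<open>The summand is written as a function of quotient and remainder, the form that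
    \<open>sum_blocks\<close> splits into a double sum.\<close>
  also have "\<dots> = (\<Sum>x = 0..<l * n.
      (\<lambda>k a. (if r div m = k then (M ! k) $$ (r mod m, a) else 0)
           * (if k = s div p then (N ! k) $$ (a, s mod p) else 0)) (x div l) (x mod l))"
    using rs by (intro sum.cong) (auto simp: bdiag_index[OF M] bdiag_index[OF N])
  also have "\<dots> = (\<Sum>k<n. \<Sum>a<l. (if r div m = k then (M ! k) $$ (r mod m, a) else 0)
           * (if k = s div p then (N ! k) $$ (a, s mod p) else 0))"
    by (rule sum_blocks)
  also have "\<dots> = (\<Sum>k<n. if r div m = k then (\<Sum>a<l. (M ! k) $$ (r mod m, a)
           * (if k = s div p then (N ! k) $$ (a, s mod p) else 0)) else 0)"
    by (intro sum.cong) auto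
  also have "\<dots> = (\<Sum>a<l. (M ! (r div m)) $$ (r mod m, a)
           * (if r div m = s div p then (N ! (r div m)) $$ (a, s mod p) else 0))"
    using div_mod_bound[OF rs(1)] by (subst sum.delta') auto
  also have "\<dots> = bdiag (map2 (*) M N) $$ (r, s)"
    using div_mod_bound[OF rs(1)] div_mod_bound[OF rs(2)]
    by (auto simp: bdiag_index[OF MN rs] map2_times_index[OF M N] simp del: nth_map)
  finally show "bdiag (map2 (*) M N) $$ (r, s) = (bdiag M * bdiag N) $$ (r, s)" ..
qed (use bdiag_carrier[OF M] bdiag_carrier[OF N] bdiag_carrier[OF map2_times_carrier[OF M N]] in auto)

text \<open>As for \<open>bdiag_mult\<close>, but the columns of the stacked factor carry no block
  index, so only the row block of \<open>r\<close> selects a slice.\<close>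

lemma bdiag_mult_unfold:
  assumes M: "M \<in> carrier_tensor m l n" and N: "N \<in> carrier_tensor l p n" and n: "n > 0"
  shows "unfold_tensor (map2 (*) M N) = bdiag M * unfold_tensor N"
proof (rule eq_matI)
  note MN = map2_times_carrier[OF M N]
  note c = bdiag_carrier[OF M] unfold_carrier[OF N n] unfold_carrier[OF MN n]
  fix r s assume "r < dim_row (bdiag M * unfold_tensor N)" "s < dim_col (bdiag M * unfold_tensor N)"
  then have rs: "r < m * n" "s < p" using c by auto
  have "(bdiag M * unfold_tensor N) $$ (r, s)
      = (\<Sum>x = 0..<l * n. bdiag M $$ (r, x) * unfold_tensor N $$ (x, s))"
    using c rs by (simp add: scalar_prod_def)
  also have "\<dots> = (\<Sum>x = 0..<l * n.
      (\<lambda>k a. (if r div m = k then (M ! k) $$ (r mod m, a) else 0) * (N ! k) $$ (a, s)) (x div l) (x mod l))"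
    using rs by (intro sum.cong) (auto simp: bdiag_index[OF M] unfold_index[OF N])
  also have "\<dots> = (\<Sum>k<n. \<Sum>a<l. (if r div m = k then (M ! k) $$ (r mod m, a) else 0) * (N ! k) $$ (a, s))"
    by (rule sum_blocks)
  also have "\<dots> = (\<Sum>k<n. if r div m = k then (\<Sum>a<l. (M ! k) $$ (r mod m, a) * (N ! k) $$ (a, s)) else 0)"
    by (intro sum.cong) auto
  also have "\<dots> = (\<Sum>a<l. (M ! (r div m)) $$ (r mod m, a) * (N ! (r div m)) $$ (a, s))"
    using div_mod_bound[OF rs(1)] by (subst sum.delta') auto
  also have "\<dots> = unfold_tensor (map2 (*) M N) $$ (r, s)"
    using div_mod_bound[OF rs(1)] rs(2)
    by (auto simp: unfold_index[OF MN rs] map2_times_index[OF M N] simp del: nth_map)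
  finally show "unfold_tensor (map2 (*) M N) $$ (r, s) = (bdiag M * unfold_tensor N) $$ (r, s)" ..
qed (use bdiag_carrier[OF M] unfold_carrier[OF N n] unfold_carrier[OF map2_times_carrier[OF M N] n] in auto)

lemma map_adjoint_carrier:
  assumes "M \<in> carrier_tensor m l n"
  shows "map mat_adjoint M \<in> carrier_tensor l m n"
  using assms by (auto simp: carrier_tensor_def)

lemma bdiag_adjoint:
  assumes M: "M \<in> carrier_tensor m l n"
  shows "bdiag (map mat_adjoint M) = mat_adjoint (bdiag M)"
proof (rule eq_matI)
  note c = bdiag_carrier[OF M]
  fix r s assume "r < dim_row (mat_adjoint (bdiag M))" "s < dim_col (mat_adjoint (bdiag M))"
  then have rs: "r < l * n" "s < m * n" using mat_adjoint_carrier[OF c] by auto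
  note b = div_mod_bound[OF rs(1)] div_mod_bound[OF rs(2)]
  show "bdiag (map mat_adjoint M) $$ (r, s) = mat_adjoint (bdiag M) $$ (r, s)"
    using b carrier_tensorD(1)[OF M] mat_adjoint_index[OF carrier_tensorD(2)[OF M b(1)] b(2) b(4)]
    by (auto simp: mat_adjoint_index[OF c rs] bdiag_index[OF M rs(2,1)]
        bdiag_index[OF map_adjoint_carrier[OF M] rs])
qed (use bdiag_carrier[OF map_adjoint_carrier[OF M]] mat_adjoint_carrier[OF bdiag_carrier[OF M]] in auto)

lemma bdiag_one:
  assumes M: "M \<in> carrier_tensor m m n" and "\<And>k. k < n \<Longrightarrow> M ! k = 1\<^sub>m m"
  shows "bdiag M = 1\<^sub>m (m * n)"
proof (rule eq_matI)
  fix r s assume "r < dim_row (1\<^sub>m (m * n) :: complex mat)" "s < dim_col (1\<^sub>m (m * n) :: complex mat)"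
  then have rs: "r < m * n" "s < m * n" by auto
  have "r = s" if "r div m = s div m" "r mod m = s mod m"
    using that by (metis div_mult_mod_eq)
  then show "bdiag M $$ (r, s) = 1\<^sub>m (m * n) $$ (r, s)"
    using assms(2) div_mod_bound[OF rs(1)] div_mod_bound[OF rs(2)] rs
    by (auto simp: bdiag_index[OF M rs])
qed (use bdiag_carrier[OF M] in auto)


section \<open>Rows belonging to a Kaczmarz block\<close>

text \<open>\<open>submatrix\<close> addresses rows through \<open>pick\<close>, the increasing
  enumeration of the index set. Exactly \<open>k\<close> elements of the block lie below
  \<open>k * m + i\<close>, which is therefore at position \<open>k\<close>.\<close>

lemma kaczmarz_block_pick:
  assumes "i < m" "k < n"
  shows "pick (kaczmarz_block m n i) k = k * m + i"
proof -
  have "{a \<in> kaczmarz_block m n i. a < k * m + i} = (\<lambda>k. k * m + i) ` {..<k}"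
    using assms by (auto simp: kaczmarz_block_def)
  moreover have "inj_on (\<lambda>k. k * m + i) {..<k}" using assms by (auto simp: inj_on_def)
  ultimately have "card {a \<in> kaczmarz_block m n i. a < k * m + i} = k" by (simp add: card_image)
  moreover have "k * m + i \<in> kaczmarz_block m n i" using assms by (auto simp: kaczmarz_block_def)
  ultimately show ?thesis using pick_card_in_set by metis
qed

text \<open>This cardinality is the row dimension that \<open>submatrix\<close> assigns to the
  selected block.\<close>

lemma kaczmarz_block_card:
  assumes "i < m"
  shows "card {r. r < m * n \<and> r \<in> kaczmarz_block m n i} = n"
proof -
  have "{r. r < m * n \<and> r \<in> kaczmarz_block m n i} = (\<lambda>k. k * m + i) ` {..<n}"
    using assms by (auto simp: kaczmarz_block_def block_index_bound)
  moreover have "inj_on (\<lambda>k. k * m + i) {..<n}" using assms by (auto simp: inj_on_def)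
  ultimately show ?thesis by (simp add: card_image)
qed

lemma row_submat_block:
  assumes M: "M \<in> carrier_mat (m * n) q" and i: "i < m"
  shows "row_submat M (kaczmarz_block m n i) = mat n q (\<lambda>(k, c). M $$ (k * m + i, c))"
  using M i kaczmarz_block_pick[OF i]
  unfolding row_submat_def submatrix_def
  by (intro eq_matI) (auto simp: kaczmarz_block_card pick_UNIV)

lemma row_slice_carrier:
  assumes "M \<in> carrier_tensor m l n"
  shows "row_slice M i \<in> carrier_tensor 1 l n"
  using assms by (auto simp: row_slice_def carrier_tensor_def mat_of_row_def)

lemma row_slice_index:
  assumes "M \<in> carrier_tensor m l n" "i < m" "k < n" "j < l"
  shows "(row_slice M i ! k) $$ (0, j) = (M ! k) $$ (i, j)"
  using carrier_tensorD(1)[OF assms(1)] carrier_tensorD(2)[OF assms(1,3)] assms(2-)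
  by (simp add: row_slice_def mat_of_row_def)

text \<open>Row \<open>k * m + i\<close> is row \<open>i\<close> of the \<open>k\<close>-th diagonal
  block, still in the columns of that block. Collecting these rows leaves a block-diagonal matrix
  with blocks of height one.\<close>

lemma row_submat_bdiag:
  assumes M: "M \<in> carrier_tensor m l n" and i: "i < m"
  shows "row_submat (bdiag M) (kaczmarz_block m n i) = bdiag (row_slice M i)"
proof -
  note c = bdiag_carrier[OF row_slice_carrier[OF M, of i]]
  show ?thesis
    unfolding row_submat_block[OF bdiag_carrier[OF M] i]
  proof (rule eq_matI)
    fix r s assume "r < dim_row (bdiag (row_slice M i))" "s < dim_col (bdiag (row_slice M i))"
    then have rs: "r < n" "s < l * n" using c by auto
    \<comment> \<open>The bound \<open>r < 1 * n\<close> is the index bound for a tensor with a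
      single row, where quotient and remainder of \<open>r\<close> by 1 are \<open>r\<close> and
      0.\<close>
    have r: "r * m + i < m * n" "(r * m + i) div m = r" "(r * m + i) mod m = i" "r < 1 * n"
      using i rs by (auto simp: block_index_bound)
    have "bdiag (row_slice M i) $$ (r, s) = bdiag M $$ (r * m + i, s)"
      unfolding bdiag_index[OF M r(1) rs(2)] bdiag_index[OF row_slice_carrier[OF M] r(4) rs(2)]
      unfolding r(2,3) using row_slice_index[OF M i rs(1)] div_mod_bound[OF rs(2)] by (metis div_by_1 mod_by_1)
    then show "mat n (l * n) (\<lambda>(k, c). bdiag M $$ (k * m + i, c)) $$ (r, s)
        = bdiag (row_slice M i) $$ (r, s)" using rs by simp
  qed (use c in auto)
qed

lemma row_submat_unfold:
  assumes M: "M \<in> carrier_tensor m l n" and i: "i < m" and n: "n > 0"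
  shows "row_submat (unfold_tensor M) (kaczmarz_block m n i) = unfold_tensor (row_slice M i)"
proof -
  note c = unfold_carrier[OF row_slice_carrier[OF M, of i] n]
  show ?thesis
    unfolding row_submat_block[OF unfold_carrier[OF M n] i]
  proof (rule eq_matI)
    fix r s assume "r < dim_row (unfold_tensor (row_slice M i))" "s < dim_col (unfold_tensor (row_slice M i))"
    then have rs: "r < n" "s < l" using c by auto
    have r: "r * m + i < m * n" "(r * m + i) div m = r" "(r * m + i) mod m = i" "r < 1 * n"
      using i rs by (auto simp: block_index_bound)
    have "unfold_tensor (row_slice M i) $$ (r, s) = unfold_tensor M $$ (r * m + i, s)"
      unfolding unfold_index[OF M r(1) rs(2)] unfold_index[OF row_slice_carrier[OF M] r(4) rs(2)]
      using r rs row_slice_index[OF M i rs(1)] by simp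
    then show "mat n l (\<lambda>(k, c). unfold_tensor M $$ (k * m + i, c)) $$ (r, s)
        = unfold_tensor (row_slice M i) $$ (r, s)" using rs by simp
  qed (use c in auto)
qed


section \<open>The Fourier transform of tensor operations\<close>

text \<open>The root of unity whose \<open>s\<close>-th power is the Fourier kernel at frequency
  \<open>k\<close> and position \<open>s\<close>. Shifts and reversals of the position thus become
  laws of natural powers.\<close>

definition dft_root :: "nat \<Rightarrow> nat \<Rightarrow> complex" where
  "dft_root n k = cis (- (2 * pi * k / n))"

lemma dft_root_power_n: "n > 0 \<Longrightarrow> dft_root n k ^ n = 1"
  using cis_multiple_2pi[of "- real k"] by (simp add: dft_root_def Complex.DeMoivre)

lemma dft_root_power_mod:
  assumes "n > 0"
  shows "dft_root n k ^ (s mod n) = dft_root n k ^ s"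
proof -
  have "dft_root n k ^ s = dft_root n k ^ (n * (s div n) + s mod n)" by simp
  then show ?thesis
    by (simp only: power_add power_mult dft_root_power_n[OF assms] power_one mult_1)
qed

lemma hat_carrier:
  assumes "M \<in> carrier_tensor m l n" "n > 0"
  shows "hat M \<in> carrier_tensor m l n"
  using carrier_tensor_dims[OF assms] by (auto simp: hat_def carrier_tensor_def)

lemma hat_index:
  assumes "M \<in> carrier_tensor m l n" "k < n" "i < m" "j < l"
  shows "(hat M ! k) $$ (i, j) = (\<Sum>s<n. dft_root n k ^ s * (M ! s) $$ (i, j))"
proof -
  have "exp (- 2 * of_real pi * \<i> * of_nat s * of_nat k / of_nat n) = dft_root n k ^ s" for s
  proof -
    have "- 2 * of_real pi * \<i> * of_nat s * of_nat k / of_nat n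
        = \<i> * complex_of_real (real s * - (2 * pi * k / n))" by simp
    then show ?thesis unfolding dft_root_def Complex.DeMoivre unfolding cis_conv_exp by (rule arg_cong)
  qed
  then show ?thesis by (simp add: hat_nth[OF assms])
qed

text \<open>Fourier inversion recovers every entry of a tensor from its transform. This is what
  makes the inverse under the t-product unique.\<close>

lemma bdiag_hat_inj:
  assumes M: "M \<in> carrier_tensor m l n" and N: "N \<in> carrier_tensor m l n" and n: "n > 0"
    and eq: "bdiag (hat M) = bdiag (hat N)"
  shows "M = N"
proof (rule tensor_eqI[OF M N])
  \<comment> \<open>The slices of \<open>hat\<close> are read off \<open>fourier_bcirc\<close>, so
    equality of the block-diagonal matrices gives equality of the transforms.\<close>
  have "fourier_bcirc M = fourier_bcirc N"
    using eq unfolding bdiag_hat[OF M n] bdiag_hat[OF N n] .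
  then have h: "hat M = hat N"
    unfolding hat_def by (simp add: carrier_tensor_dims[OF M n] carrier_tensor_dims[OF N n])
  fix t i j assume ijt: "t < n" "i < m" "j < l"
  define v where "v = cis (2 * pi / n)"
  \<comment> \<open>The inverse transform without its factor 1/n. After exchanging the sums,
    orthogonality of the roots of unity (\<open>root_sum\<close>) keeps only
    \<open>s = t\<close>.\<close>
  have inversion: "(\<Sum>k<n. v ^ (k * t) * (hat T ! k) $$ (i, j)) = of_nat n * (T ! t) $$ (i, j)"
    if T: "T \<in> carrier_tensor m l n" for T
  proof -
    have root: "dft_root n k ^ s = v powi (- int (s * k))" for s k
      unfolding v_def cis_powi_minus dft_root_def Complex.DeMoivre by (simp add: algebra_simps)
    have "(\<Sum>k<n. v ^ (k * t) * (hat T ! k) $$ (i, j))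
        = (\<Sum>k<n. \<Sum>s<n. v powi (- int (s * k)) * v ^ (k * t) * (T ! s) $$ (i, j))"
      using ijt by (intro sum.cong) (simp_all add: hat_index[OF T] root sum_distrib_left mult_ac)
    also have "\<dots> = (\<Sum>s<n. (\<Sum>k<n. v powi (- int (s * k)) * v ^ (k * t)) * (T ! s) $$ (i, j))"
      by (subst sum.swap) (simp only: sum_distrib_right)
    also have "\<dots> = (\<Sum>s<n. if s = t then of_nat n * (T ! s) $$ (i, j) else 0)"
      using ijt(1) by (intro sum.cong) (auto simp: root_sum v_def simp del: of_nat_mult)
    also have "\<dots> = of_nat n * (T ! t) $$ (i, j)" using ijt by simp
    finally show ?thesis .
  qed
  show "(M ! t) $$ (i, j) = (N ! t) $$ (i, j)"
    using inversion[OF M] inversion[OF N] h n by simp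
qed

section \<open>The convolution theorem for the t-product\<close>

lemma t_prod_carrier:
  assumes M: "M \<in> carrier_tensor m l n" and N: "N \<in> carrier_tensor l p n" and n: "n > 0"
  shows "t_prod M N \<in> carrier_tensor m p n"
  by (auto simp: t_prod_def fold_tensor_def carrier_tensor_def unfold_tensor_def
      carrier_tensor_dims[OF M n] carrier_tensor_dims[OF N n])

text \<open>Block by block, multiplication by the block-circulant matrix is a circular convolution
  of frontal slices.\<close>

lemma t_prod_index:
  assumes M: "M \<in> carrier_tensor m l n" and N: "N \<in> carrier_tensor l p n"
    and b: "s < n" "i < m" "j < p"
  shows "(t_prod M N ! s) $$ (i, j) =
    (\<Sum>u<n. \<Sum>a<l. (M ! nat ((int s - int u) mod int n)) $$ (i, a) * (N ! u) $$ (a, j))"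
proof -
  have n: "n > 0" using b by simp
  note d = carrier_tensor_dims[OF M n] and e = carrier_tensor_dims[OF N n]
  note U = unfold_carrier[OF N n]
  have r: "s * m + i < m * n" "(s * m + i) div m = s" "(s * m + i) mod m = i"
    using b by (auto simp: block_index_bound)
  have bc: "bcirc M \<in> carrier_mat (m * n) (l * n)" by (simp add: bcirc_def d)
  have "(t_prod M N ! s) $$ (i, j) = (bcirc M * unfold_tensor N) $$ (s * m + i, j)"
    using b U by (simp add: t_prod_def fold_tensor_def d)
  also have "\<dots> = (\<Sum>x = 0..<l * n. bcirc M $$ (s * m + i, x) * unfold_tensor N $$ (x, j))"
    using b r U bc by (simp add: scalar_prod_def)
  also have "\<dots> = (\<Sum>x = 0..<l * n.
      (\<lambda>u a. (M ! nat ((int s - int u) mod int n)) $$ (i, a) * (N ! u) $$ (a, j)) (x div l) (x mod l))"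
    using r b by (intro sum.cong) (auto simp: bcirc_def d unfold_index[OF N])
  also have "\<dots> = (\<Sum>u<n. \<Sum>a<l. (M ! nat ((int s - int u) mod int n)) $$ (i, a) * (N ! u) $$ (a, j))"
    by (rule sum_blocks)
  finally show ?thesis .
qed

text \<open>The shift theorem: substitute \<open>s = (v + u) mod n\<close> and use that the powers
  of \<open>dft_root n k\<close> are periodic with period \<open>n\<close>.\<close>

lemma dft_shift:
  fixes f :: "nat \<Rightarrow> complex"
  assumes "u < n"
  shows "(\<Sum>s<n. dft_root n k ^ s * f (nat ((int s - int u) mod int n)))
       = dft_root n k ^ u * (\<Sum>v<n. dft_root n k ^ v * f v)"
proof -
  have "(\<Sum>s<n. dft_root n k ^ s * f (nat ((int s - int u) mod int n)))
      = (\<Sum>v<n. dft_root n k ^ ((v + u) mod n) * f (nat ((int ((v + u) mod n) - int u) mod int n)))"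
    \<comment> \<open>The inverse shift adds \<open>n - u\<close>, since subtracting
      \<open>u\<close> from \<open>s\<close> would truncate.\<close>
    by (rule sum.reindex_bij_witness[of _ "\<lambda>v. (v + u) mod n" "\<lambda>s. (s + (n - u)) mod n"])
       (use assms in \<open>auto simp: mod_simps\<close>, simp add: shift_mod)
  also have "\<dots> = (\<Sum>v<n. dft_root n k ^ u * (dft_root n k ^ v * f v))"
  proof (rule sum.cong[OF refl])
    fix v assume "v \<in> {..<n}"
    then have "nat ((int ((v + u) mod n) - int u) mod int n) = v"
      by (simp add: zmod_int mod_simps)
    then show "dft_root n k ^ ((v + u) mod n) * f (nat ((int ((v + u) mod n) - int u) mod int n))
        = dft_root n k ^ u * (dft_root n k ^ v * f v)"
      using assms by (simp add: dft_root_power_mod power_add mult_ac)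
  qed
  finally show ?thesis by (simp add: sum_distrib_left)
qed

lemma hat_t_prod:
  assumes M: "M \<in> carrier_tensor m l n" and N: "N \<in> carrier_tensor l p n" and n: "n > 0"
  shows "hat (t_prod M N) = map2 (*) (hat M) (hat N)"
proof (rule tensor_eqI)
  note MN = t_prod_carrier[OF M N n] and hM = hat_carrier[OF M n] and hN = hat_carrier[OF N n]
  show "hat (t_prod M N) \<in> carrier_tensor m p n" by (rule hat_carrier[OF MN n])
  show "map2 (*) (hat M) (hat N) \<in> carrier_tensor m p n" by (rule map2_times_carrier[OF hM hN])
  fix k i j assume b: "k < n" "i < m" "j < p"
  let ?w = "dft_root n k"
  have "(hat (t_prod M N) ! k) $$ (i, j)
      = (\<Sum>s<n. \<Sum>u<n. \<Sum>a<l. ?w ^ s * (M ! nat ((int s - int u) mod int n)) $$ (i, a) * (N ! u) $$ (a, j))"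
    using b by (simp add: hat_index[OF MN] t_prod_index[OF M N] sum_distrib_left mult_ac)
  \<comment> \<open>With the sum over \<open>s\<close> innermost, \<open>dft_shift\<close> applies
    for each fixed \<open>u\<close> and \<open>a\<close> and separates the two transforms.\<close>
  also have "\<dots> = (\<Sum>u<n. \<Sum>a<l. \<Sum>s<n. ?w ^ s * (M ! nat ((int s - int u) mod int n)) $$ (i, a) * (N ! u) $$ (a, j))"
    by (subst sum.swap) (intro sum.cong refl sum.swap)
  also have "\<dots> = (\<Sum>u<n. \<Sum>a<l. ?w ^ u * (\<Sum>v<n. ?w ^ v * (M ! v) $$ (i, a)) * (N ! u) $$ (a, j))"
    by (intro sum.cong refl) (simp add: dft_shift[where f = "\<lambda>v. (M ! v) $$ _"] flip: sum_distrib_right)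
  also have "\<dots> = (\<Sum>a<l. \<Sum>u<n. (\<Sum>v<n. ?w ^ v * (M ! v) $$ (i, a)) * (?w ^ u * (N ! u) $$ (a, j)))"
    by (subst sum.swap) (simp only: mult_ac)
  also have "\<dots> = (\<Sum>a<l. (hat M ! k) $$ (i, a) * (hat N ! k) $$ (a, j))"
    using b by (simp add: hat_index[OF M] hat_index[OF N] flip: sum_distrib_left)
  also have "\<dots> = (map2 (*) (hat M) (hat N) ! k) $$ (i, j)"
    using b by (simp add: map2_times_index[OF hM hN] del: nth_map)
  finally show "(hat (t_prod M N) ! k) $$ (i, j) = (map2 (*) (hat M) (hat N) ! k) $$ (i, j)" .
qed

lemma bdiag_hat_t_prod:
  assumes "M \<in> carrier_tensor m l n" "N \<in> carrier_tensor l p n" "n > 0"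
  shows "bdiag (hat (t_prod M N)) = bdiag (hat M) * bdiag (hat N)"
  using hat_t_prod[OF assms] bdiag_mult hat_carrier assms by metis

lemma unfold_hat_t_prod:
  assumes "M \<in> carrier_tensor m l n" "N \<in> carrier_tensor l p n" "n > 0"
  shows "unfold_tensor (hat (t_prod M N)) = bdiag (hat M) * unfold_tensor (hat N)"
  using hat_t_prod[OF assms] bdiag_mult_unfold hat_carrier assms by metis

section \<open>Conjugate transpose and identity in the Fourier domain\<close>

lemma t_adjoint_carrier:
  assumes "M \<in> carrier_tensor m l n"
  shows "t_adjoint M \<in> carrier_tensor l m n"
  using carrier_tensorD[OF assms] by (intro carrier_tensorI) (auto simp: t_adjoint_def)

text \<open>Reducing \<open>n - k\<close> modulo \<open>n\<close> sends slice 0 to itself and so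
  merges the two cases of the definition.\<close>

lemma t_adjoint_nth:
  assumes "M \<in> carrier_tensor m l n" "k < n"
  shows "t_adjoint M ! k = mat_adjoint (M ! ((n - k) mod n))"
  using carrier_tensorD(1)[OF assms(1)] assms(2) by (auto simp: t_adjoint_def)

lemma hat_t_adjoint:
  assumes M: "M \<in> carrier_tensor m l n" and n: "n > 0"
  shows "hat (t_adjoint M) = map mat_adjoint (hat M)"
proof (rule tensor_eqI)
  note Ms = t_adjoint_carrier[OF M] and hM = hat_carrier[OF M n]
  show "hat (t_adjoint M) \<in> carrier_tensor l m n" by (rule hat_carrier[OF Ms n])
  show "map mat_adjoint (hat M) \<in> carrier_tensor l m n" by (rule map_adjoint_carrier[OF hM])
  fix k i j assume b: "k < n" "i < l" "j < m"
  let ?w = "dft_root n k"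
  \<comment> \<open>Both sides are inverse to \<open>?w ^ s\<close>: on the unit circle conjugation
    is inversion, and \<open>?w ^ n\<close> is 1.\<close>
  have conj: "?w ^ ((n - s) mod n) = cnj (?w ^ s)" if "s < n" for s
  proof -
    have "?w ^ (n - s) * ?w ^ s = ?w ^ n" using that by (simp flip: power_add)
    also have "\<dots> = 1" using n by (rule dft_root_power_n)
    also have "\<dots> = cnj (?w ^ s) * ?w ^ s"
      by (simp add: dft_root_def cis_cnj cis_mult Complex.DeMoivre)
    finally show ?thesis using dft_root_power_mod[OF n] by (simp add: dft_root_def)
  qed
  \<comment> \<open>The reversal of positions is an involution, so it serves as its own inverse in
    the reindexing below.\<close>
  have refl_mod: "(n - (n - s) mod n) mod n = s" if "s < n" for s
    using that by (cases "s = 0") auto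
  have "(hat (t_adjoint M) ! k) $$ (i, j) = (\<Sum>s<n. ?w ^ s * cnj ((M ! ((n - s) mod n)) $$ (j, i)))"
    unfolding hat_index[OF Ms b]
    by (intro sum.cong refl)
       (use b n in \<open>simp add: t_adjoint_nth[OF M] mat_adjoint_index[OF carrier_tensorD(2)[OF M]]\<close>)
  also have "\<dots> = (\<Sum>s<n. ?w ^ ((n - s) mod n) * cnj ((M ! s) $$ (j, i)))"
    by (rule sum.reindex_bij_witness[of _ "\<lambda>s. (n - s) mod n" "\<lambda>s. (n - s) mod n"])
       (auto simp: refl_mod)
  also have "\<dots> = cnj ((hat M ! k) $$ (j, i))"
    using b by (simp add: hat_index[OF M] conj)
  also have "\<dots> = (map mat_adjoint (hat M) ! k) $$ (i, j)"
    using b carrier_tensorD[OF hM] by (simp add: mat_adjoint_index[OF carrier_tensorD(2)[OF hM]])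
  finally show "(hat (t_adjoint M) ! k) $$ (i, j) = (map mat_adjoint (hat M) ! k) $$ (i, j)" .
qed

lemma bdiag_hat_t_adjoint:
  assumes "M \<in> carrier_tensor m l n" "n > 0"
  shows "bdiag (hat (t_adjoint M)) = mat_adjoint (bdiag (hat M))"
  using hat_t_adjoint[OF assms] bdiag_adjoint[OF hat_carrier[OF assms]] by simp

lemma t_id_carrier: "t_id m n \<in> carrier_tensor m m n"
  by (auto simp: t_id_def carrier_tensor_def)

text \<open>Only slice 0 contributes to the transform, with weight 1 at every frequency.\<close>

lemma bdiag_hat_t_id:
  assumes n: "n > 0"
  shows "bdiag (hat (t_id m n)) = 1\<^sub>m (m * n)"
proof (rule bdiag_one)
  note h = hat_carrier[OF t_id_carrier n, of m]
  show "hat (t_id m n) \<in> carrier_tensor m m n" by (rule h)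
  fix k assume k: "k < n"
  show "hat (t_id m n) ! k = 1\<^sub>m m"
  proof (rule eq_matI)
    fix i j assume "i < dim_row (1\<^sub>m m :: complex mat)" "j < dim_col (1\<^sub>m m :: complex mat)"
    then have ij: "i < m" "j < m" by auto
    have "(hat (t_id m n) ! k) $$ (i, j)
        = (\<Sum>s<n. if s = 0 then 1\<^sub>m m $$ (i, j) else 0)"
      unfolding hat_index[OF t_id_carrier k ij]
      by (intro sum.cong refl) (use ij in \<open>auto simp: t_id_def\<close>)
    then show "(hat (t_id m n) ! k) $$ (i, j) = 1\<^sub>m m $$ (i, j)" using n by simp
  qed (use carrier_tensorD(2)[OF h k] in auto)
qed

section \<open>Differences, row slices and inverses\<close>

lemma t_minus_carrier:
  assumes "M \<in> carrier_tensor m l n" "N \<in> carrier_tensor m l n"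
  shows "t_minus M N \<in> carrier_tensor m l n"
  using carrier_tensorD[OF assms(1)] carrier_tensorD[OF assms(2)]
  by (intro carrier_tensorI) (auto simp: t_minus_def intro: minus_carrier_mat)

lemma t_minus_index:
  assumes "M \<in> carrier_tensor m l n" "N \<in> carrier_tensor m l n" "k < n" "i < m" "j < l"
  shows "(t_minus M N ! k) $$ (i, j) = (M ! k) $$ (i, j) - (N ! k) $$ (i, j)"
  using carrier_tensorD(1)[OF assms(1)] carrier_tensorD(1)[OF assms(2)]
    carrier_tensorD(2)[OF assms(1,3)] carrier_tensorD(2)[OF assms(2,3)] assms(3-)
  by (simp add: t_minus_def)

lemma unfold_hat_t_minus:
  assumes M: "M \<in> carrier_tensor m l n" and N: "N \<in> carrier_tensor m l n" and n: "n > 0"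
  shows "unfold_tensor (hat (t_minus M N)) = unfold_tensor (hat M) - unfold_tensor (hat N)"
proof (rule eq_matI)
  note MN = t_minus_carrier[OF M N]
  note h = hat_carrier[OF M n] hat_carrier[OF N n] hat_carrier[OF MN n]
  note c = unfold_carrier[OF h(1) n] unfold_carrier[OF h(2) n] unfold_carrier[OF h(3) n]
  show "dim_row (unfold_tensor (hat (t_minus M N))) = dim_row (unfold_tensor (hat M) - unfold_tensor (hat N))"
    "dim_col (unfold_tensor (hat (t_minus M N))) = dim_col (unfold_tensor (hat M) - unfold_tensor (hat N))"
    using c by auto
  fix r s
  assume "r < dim_row (unfold_tensor (hat M) - unfold_tensor (hat N))"
    "s < dim_col (unfold_tensor (hat M) - unfold_tensor (hat N))"
  then have rs: "r < m * n" "s < l" using c by auto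
  show "unfold_tensor (hat (t_minus M N)) $$ (r, s) = (unfold_tensor (hat M) - unfold_tensor (hat N)) $$ (r, s)"
    using rs c div_mod_bound[OF rs(1)]
    by (simp add: unfold_index[OF h(1)] unfold_index[OF h(2)] unfold_index[OF h(3)] hat_index[OF M]
        hat_index[OF N] hat_index[OF MN] t_minus_index[OF M N] right_diff_distrib sum_subtractf)
qed

text \<open>The transform acts along the third mode only and hence commutes with the selection of a
  row.\<close>

lemma hat_row_slice:
  assumes M: "M \<in> carrier_tensor m l n" and n: "n > 0" and i: "i < m"
  shows "hat (row_slice M i) = row_slice (hat M) i"
proof (rule tensor_eqI)
  note R = row_slice_carrier[OF M, of i]
  show "hat (row_slice M i) \<in> carrier_tensor 1 l n" by (rule hat_carrier[OF R n])
  show "row_slice (hat M) i \<in> carrier_tensor 1 l n" by (rule row_slice_carrier[OF hat_carrier[OF M n]])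
  fix k r j assume b: "k < n" "r < (1::nat)" "j < l"
  have r: "r = 0" using b by simp
  show "(hat (row_slice M i) ! k) $$ (r, j) = (row_slice (hat M) i ! k) $$ (r, j)"
    unfolding hat_index[OF R b] unfolding r row_slice_index[OF hat_carrier[OF M n] i b(1,3)] hat_index[OF M b(1) i b(3)]
    by (intro sum.cong refl) (use b in \<open>simp add: row_slice_index[OF M i]\<close>)
qed

text \<open>The definite description \<open>t_inv\<close> requires uniqueness. It is proved on the
  Fourier side, where associativity comes from matrix multiplication and
  \<open>bdiag_hat_inj\<close> leads back to tensors.\<close>

lemma t_inv_correct:
  assumes M: "M \<in> carrier_tensor m m n" and n: "n > 0" and inv: "t_invertible M"
  shows "t_inv M \<in> carrier_tensor m m n" "t_prod M (t_inv M) = t_id m n"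
proof -
  \<comment> \<open>The dimensions in \<open>t_inverse_of\<close> are existentially quantified; the
    length and the first slice of \<open>M\<close> determine them.\<close>
  have inverse_dest: "N \<in> carrier_tensor m m n \<and> t_prod M N = t_id m n \<and> t_prod N M = t_id m n"
    if N: "t_inverse_of M N" for N
  proof -
    obtain m' n' where *: "M \<in> carrier_tensor m' m' n'" "N \<in> carrier_tensor m' m' n'"
      "t_prod M N = t_id m' n'" "t_prod N M = t_id m' n'"
      using N by (auto simp: t_inverse_of_def)
    have n': "n' = n" using carrier_tensorD(1)[OF M] carrier_tensorD(1)[OF *(1)] by simp
    then have "m' = m" using carrier_tensor_dims(2)[OF M n] carrier_tensor_dims(2)[OF *(1)] n by simp
    then show ?thesis using * n' by simp
  qed
  have unique: "N = N'" if N: "t_inverse_of M N" and N': "t_inverse_of M N'" for N N'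
  proof (rule bdiag_hat_inj)
    note d = inverse_dest[OF N] and d' = inverse_dest[OF N']
    show "N \<in> carrier_tensor m m n" "N' \<in> carrier_tensor m m n" "n > 0" using d d' n by auto
    let ?X = "bdiag (hat M)" and ?Y = "bdiag (hat N)" and ?Z = "bdiag (hat N')"
    have c: "?X \<in> carrier_mat (m * n) (m * n)" "?Y \<in> carrier_mat (m * n) (m * n)"
      "?Z \<in> carrier_mat (m * n) (m * n)"
      using M d d' n by (auto intro!: bdiag_carrier hat_carrier)
    \<comment> \<open>One inverse is used on the left and the other on the right of
      \<open>?X\<close>, whence \<open>?Y = ?Y * ?X * ?Z = ?Z\<close>.\<close>
    have "?X * ?Z = 1\<^sub>m (m * n)" "?Y * ?X = 1\<^sub>m (m * n)"
      using bdiag_hat_t_prod[OF M _ n] bdiag_hat_t_prod[OF _ M n] d d' bdiag_hat_t_id[OF n] by metis+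
    then show "?Y = ?Z"
      using assoc_mult_mat[OF c(2,1,3)] c by simp
  qed
  obtain N where N: "t_inverse_of M N" using inv by (auto simp: t_invertible_def)
  have "t_inv M = N" unfolding t_inv_def using N unique by (intro the_equality)
  then show "t_inv M \<in> carrier_tensor m m n" "t_prod M (t_inv M) = t_id m n"
    using inverse_dest[OF N] by auto
qed


section \<open>Equivalence of the two iterations\<close>

text \<open>The transform carries the defining equation of the tensor inverse to the right-inverse
  hypothesis of \<open>pinv_full_row_rank\<close>. The main result uses it with
  \<open>q = 1\<close>.\<close>

lemma pinv_bdiag_hat:
  assumes R: "R \<in> carrier_tensor q l n" and n: "n > 0"
    and inv: "t_invertible (t_prod R (t_adjoint R))"
  shows "pinv (bdiag (hat R)) = bdiag (hat (t_prod (t_adjoint R) (t_inv (t_prod R (t_adjoint R)))))"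
proof -
  note S = t_adjoint_carrier[OF R]
  note G = t_prod_carrier[OF R S n]
  note H = t_inv_correct[OF G n inv]
  let ?D = "bdiag (hat R)" and ?H = "bdiag (hat (t_inv (t_prod R (t_adjoint R))))"
  have "?D * mat_adjoint ?D * ?H = 1\<^sub>m (q * n)"
    using bdiag_hat_t_prod[OF G H(1) n] bdiag_hat_t_prod[OF R S n] bdiag_hat_t_adjoint[OF R n]
      bdiag_hat_t_id[OF n] H(2) by simp
  then have "pinv ?D = mat_adjoint ?D * ?H"
    by (rule pinv_full_row_rank[OF bdiag_carrier[OF hat_carrier[OF R n]] bdiag_carrier[OF hat_carrier[OF H(1) n]]])
  then show ?thesis
    using bdiag_hat_t_prod[OF S H(1) n] bdiag_hat_t_adjoint[OF R n] by simp
qed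

theorem mainTheorem3:
  fixes m l n p :: nat
    and A B X0 :: tensor
    and idx :: "nat \<Rightarrow> nat"
  assumes "n > 0"
    and "A \<in> carrier_tensor m l n"
    and "B \<in> carrier_tensor m p n"
    and "X0 \<in> carrier_tensor l p n"
    and "\<And>i. i < m \<Longrightarrow> t_invertible (t_prod (row_slice A i) (t_adjoint (row_slice A i)))"
    and "\<And>t. idx t < m"
  shows "\<forall>t. block_kaczmarz (bdiag (hat A)) (unfold_tensor (hat B))
               (\<lambda>s. kaczmarz_block m n (idx s)) (unfold_tensor (hat X0)) t
             = unfold_tensor (hat (tensor_kaczmarz A B idx X0 t))"
proof
  fix t
  \<comment> \<open>The induction also carries the dimensions of the iterate, on which all transfer
    lemmas depend.\<close>
  have "tensor_kaczmarz A B idx X0 t \<in> carrier_tensor l p n \<and>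
    block_kaczmarz (bdiag (hat A)) (unfold_tensor (hat B))
      (\<lambda>s. kaczmarz_block m n (idx s)) (unfold_tensor (hat X0)) t
    = unfold_tensor (hat (tensor_kaczmarz A B idx X0 t))"
  proof (induction t)
    case 0
    show ?case using assms(4) by simp
  next
    case (Suc t)
    let ?X = "tensor_kaczmarz A B idx X0 t"
    let ?i = "idx t"
    let ?R = "row_slice A ?i" and ?b = "row_slice B ?i"
    let ?P = "t_prod (t_adjoint ?R) (t_inv (t_prod ?R (t_adjoint ?R)))"
    let ?e = "t_minus (t_prod ?R ?X) ?b"
    note n = assms(1) and A = assms(2) and B = assms(3) and i = assms(6)[of t]
    have X: "?X \<in> carrier_tensor l p n" using Suc by simp
    note R = row_slice_carrier[OF A, of ?i] and b = row_slice_carrier[OF B, of ?i]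
    note S = t_adjoint_carrier[OF R]
    note P = t_prod_carrier[OF S t_inv_correct(1)[OF t_prod_carrier[OF R S n] n assms(5)[OF i]] n]
    note RX = t_prod_carrier[OF R X n]
    note e = t_minus_carrier[OF RX b]
    note Pe = t_prod_carrier[OF P e n]
    have "unfold_tensor (hat (t_minus ?X (t_prod ?P ?e)))
        = unfold_tensor (hat ?X) - bdiag (hat ?P) *
            (bdiag (hat ?R) * unfold_tensor (hat ?X) - unfold_tensor (hat ?b))"
      unfolding unfold_hat_t_minus[OF X Pe n] unfold_hat_t_prod[OF P e n]
        unfold_hat_t_minus[OF RX b n] unfold_hat_t_prod[OF R X n] ..
    \<comment> \<open>The pseudoinverse is introduced first, so that its argument is recognised as a
      row block together with the other occurrence of \<open>bdiag (hat ?R)\<close>.\<close>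
    also have "bdiag (hat ?P) = pinv (bdiag (hat ?R))"
      using pinv_bdiag_hat[OF R n assms(5)[OF i]] by simp
    also have "bdiag (hat ?R) = row_submat (bdiag (hat A)) (kaczmarz_block m n ?i)"
      using row_submat_bdiag[OF hat_carrier[OF A n] i] hat_row_slice[OF A n i] by simp
    also have "unfold_tensor (hat ?b) = row_submat (unfold_tensor (hat B)) (kaczmarz_block m n ?i)"
      using row_submat_unfold[OF hat_carrier[OF B n] i n] hat_row_slice[OF B n i] by simp
    finally show ?case
      using Suc t_minus_carrier[OF X Pe] by (simp add: Let_def)
  qed
  then show "block_kaczmarz (bdiag (hat A)) (unfold_tensor (hat B))
      (\<lambda>s. kaczmarz_block m n (idx s)) (unfold_tensor (hat X0)) t
    = unfold_tensor (hat (tensor_kaczmarz A B idx X0 t))" by simp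
qed

end
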